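(* Let $G$ be a finite simple connected graph with $n$ vertices and $m$ edges. Then $$\begin{aligned}F(G^{+-+})={}&(3m+17)F(G)-3(m+3)^2M_1(G)+6(m+3)M_2(G)-\xi_4(G)\\&-3\,\mathrm{ReZG}_3(G)+m(m+3)^3.\end{aligned}$$
   Context: For a finite simple graph $H$ with vertex set $V(H)$ and edge set $E(H)$, $d_H(v)$ denotes the degree of the vertex $v$ in $H$. The F-index of $H$ is $F(H)=\sum_{v\in V(H)} d_H(v)^3$. The first and second Zagreb indices are $M_1(H)=\sum_{v\in V(H)} d_H(v)^2$ and $M_2(H)=\sum_{uv\in E(H)} d_H(u)d_H(v)$. Further, $\xi_4(H)=\sum_{v\in V(H)} d_H(v)^4=\sum_{uv\in E(H)}[d_H(u)^3+d_H(v)^3]$ and $\mathrm{ReZG}_3(H)=\sum_{uv\in E(H)} d_H(u)d_H(v)[d_H(u)+d_H(v)]$. For $x,y,z\in\{+,-\}$, the total transformation graph $G^{xyz}$ is the simple graph with vertex set $V(G)\cup E(G)$ (disjoint union) in which two distinct elements $u,v$ are adjacent if and only if one of the following holds: (i) $u,v\in V(G)$, and $u,v$ are adjacent in $G$ if $x=+$, respectively not adjacent in $G$ if $x=-$; (ii) $u,v\in E(G)$, and $u,v$ are adjacent in $G$ (share an endpoint) if $y=+$, respectively not adjacent in $G$ if $y=-$; (iii) one of them is a vertex of $G$ and the other is an edge of $G$, and they are incident in $G$ if $z=+$, respectively not incident in $G$ if $z=-$. *)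

theory Defs
  imports Main
begin

record 'v graph =
  verts :: "'v set"
  edges :: "'v set set"

definition finite_simple_graph :: "'v graph \<Rightarrow> bool" where
  "finite_simple_graph G \<longleftrightarrow>
     finite (verts G) \<and> (\<forall>e \<in> edges G. e \<subseteq> verts G \<and> card e = 2)"

definition vertex_adj :: "'v graph \<Rightarrow> 'v \<Rightarrow> 'v \<Rightarrow> bool" where
  "vertex_adj G u v \<longleftrightarrow> {u, v} \<in> edges G"

definition edge_adj :: "'v set \<Rightarrow> 'v set \<Rightarrow> bool" where
  "edge_adj e f \<longleftrightarrow> e \<noteq> f \<and> e \<inter> f \<noteq> {}"

text \<open>The graph without vertices counts as connected here.\<close>

definition connected_graph :: "'v graph \<Rightarrow> bool" where
  "connected_graph G \<longleftrightarrow>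
     (\<forall>u \<in> verts G. \<forall>v \<in> verts G. (vertex_adj G)\<^sup>*\<^sup>* u v)"

definition degree :: "'v graph \<Rightarrow> 'v \<Rightarrow> nat" where
  "degree G v = card {e \<in> edges G. v \<in> e}"

definition F_index :: "'v graph \<Rightarrow> nat" where
  "F_index G = (\<Sum>v \<in> verts G. degree G v ^ 3)"

definition zagreb1 :: "'v graph \<Rightarrow> nat" where
  "zagreb1 G = (\<Sum>v \<in> verts G. degree G v ^ 2)"

text \<open>
  An edge is a set \<open>{u, v}\<close> with \<open>u \<noteq> v\<close>, so a product or sum over its elements
  is \<open>d(u) * d(v)\<close> or \<open>d(u) + d(v)\<close>, without a choice of orientation.
\<close>

definition zagreb2 :: "'v graph \<Rightarrow> nat" where
  "zagreb2 G = (\<Sum>e \<in> edges G. \<Prod>v \<in> e. degree G v)"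

definition xi4 :: "'v graph \<Rightarrow> nat" where
  "xi4 G = (\<Sum>v \<in> verts G. degree G v ^ 4)"

definition ReZG3 :: "'v graph \<Rightarrow> nat" where
  "ReZG3 G = (\<Sum>e \<in> edges G. (\<Prod>v \<in> e. degree G v) * (\<Sum>v \<in> e. degree G v))"

datatype sign = Plus | Minus

fun signed :: "sign \<Rightarrow> bool \<Rightarrow> bool" where
  "signed Plus P \<longleftrightarrow> P"
| "signed Minus P \<longleftrightarrow> \<not> P"

fun transformation_adj ::
  "sign \<Rightarrow> sign \<Rightarrow> sign \<Rightarrow> 'v graph \<Rightarrow> 'v + 'v set \<Rightarrow> 'v + 'v set \<Rightarrow> bool" where
  "transformation_adj x y z G (Inl u) (Inl v) \<longleftrightarrow> signed x (vertex_adj G u v)"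
| "transformation_adj x y z G (Inr e) (Inr f) \<longleftrightarrow> signed y (edge_adj e f)"
| "transformation_adj x y z G (Inl v) (Inr e) \<longleftrightarrow> signed z (v \<in> e)"
| "transformation_adj x y z G (Inr e) (Inl v) \<longleftrightarrow> signed z (v \<in> e)"

definition total_transformation ::
  "sign \<Rightarrow> sign \<Rightarrow> sign \<Rightarrow> 'v graph \<Rightarrow> ('v + 'v set) graph" where
  "total_transformation x y z G =
     \<lparr> verts = verts G <+> edges G,
       edges = {{p, q} | p q. p \<in> verts G <+> edges G \<and> q \<in> verts G <+> edges G
                  \<and> p \<noteq> q \<and> transformation_adj x y z G p q} \<rparr>"

lemma finite_edges:
  assumes "finite_simple_graph G"
  shows "finite (edges G)"
proof (rule finite_subset)
  show "edges G \<subseteq> Pow (verts G)" "finite (Pow (verts G))"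
    using assms by (auto simp: finite_simple_graph_def)
qed

lemma finite_simple_graph_total_transformation:
  assumes "finite_simple_graph G"
  shows "finite_simple_graph (total_transformation x y z G)"
proof -
  have "finite (verts G <+> edges G)"
    using assms finite_edges[OF assms] by (simp add: finite_simple_graph_def)
  moreover have "card {p, q} = 2" if "p \<noteq> q" for p q :: "'a + 'a set"
    using that by simp
  ultimately show ?thesis
    unfolding finite_simple_graph_def total_transformation_def by (simp, blast)
qed

end

theory Submission imports Defs begin

text \<open>
  A vertex \<open>v\<close> of \<open>G\<close> has degree \<open>2 d(v)\<close> in \<open>G\<^sup>+\<^sup>-\<^sup>+\<close>. An edge \<open>uv\<close> meets
  \<open>d(u) + d(v) - 2\<close> other edges, hence has degree \<open>m + 3 - (d(u) + d(v))\<close> there. The cube of the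
  latter is expanded, and sums over the ends of edges become sums over vertices weighted by degree.
\<close>

lemma edge_cases:
  assumes "finite_simple_graph G" "e \<in> edges G"
  obtains u v where "u \<noteq> v" "e = {u, v}" "u \<in> verts G" "v \<in> verts G"
proof -
  have "e \<subseteq> verts G" "card e = 2"
    using assms by (auto simp: finite_simple_graph_def)
  then show thesis
    using that by (auto simp: card_2_iff)
qed

text \<open>Double counting of incident pairs: in the sum over all edges and their ends,
  \<open>g v\<close> appears once for each edge at \<open>v\<close>, that is
  \<open>degree G v\<close> times.\<close>

lemma sum_edges_sum_ends:
  fixes g :: "'v \<Rightarrow> 'a::comm_semiring_1"
  assumes G: "finite_simple_graph G"
  shows "(\<Sum>e\<in>edges G. \<Sum>v\<in>e. g v) = (\<Sum>v\<in>verts G. of_nat (degree G v) * g v)"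
proof -
  have fin: "finite (verts G)" and sub: "\<And>e. e \<in> edges G \<Longrightarrow> e \<subseteq> verts G"
    using G by (auto simp: finite_simple_graph_def)
  have "(\<Sum>e\<in>edges G. \<Sum>v\<in>e. g v) = (\<Sum>e\<in>edges G. \<Sum>v | v \<in> verts G \<and> v \<in> e. g v)"
    using sub by (intro sum.cong) auto
  also have "\<dots> = (\<Sum>v\<in>verts G. \<Sum>e | e \<in> edges G \<and> v \<in> e. g v)"
    by (rule sum.swap_restrict) (use fin finite_edges[OF G] in auto)
  finally show ?thesis by (simp add: degree_def)
qed

text \<open>The map from \<open>u\<close> to \<open>{v, u}\<close> is a bijection from the
  neighbours of \<open>v\<close> to the edges at \<open>v\<close>. This gives access to degrees in a
  transformation graph, whose edges are known only through an adjacency relation.\<close>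

lemma card_neighbours_eq_degree:
  assumes "finite_simple_graph G"
  shows "card {u \<in> verts G. u \<noteq> v \<and> vertex_adj G v u} = degree G v"
proof -
  have "bij_betw (\<lambda>u. {v, u}) {u \<in> verts G. u \<noteq> v \<and> vertex_adj G v u} {e \<in> edges G. v \<in> e}"
    unfolding bij_betw_def
  proof
    show "inj_on (\<lambda>u. {v, u}) {u \<in> verts G. u \<noteq> v \<and> vertex_adj G v u}"
      by (auto simp: inj_on_def doubleton_eq_iff)
    show "(\<lambda>u. {v, u}) ` {u \<in> verts G. u \<noteq> v \<and> vertex_adj G v u} = {e \<in> edges G. v \<in> e}"
    proof (intro equalityI subsetI)
      fix e assume "e \<in> {e \<in> edges G. v \<in> e}"
      then have e: "e \<in> edges G" "v \<in> e" by auto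
      obtain a b where "a \<noteq> b" "e = {a, b}" "a \<in> verts G" "b \<in> verts G"
        using edge_cases[OF assms e(1)] .
      with e(2) have "\<exists>u. u \<in> verts G \<and> u \<noteq> v \<and> e = {v, u}"
        by (auto simp: insert_commute)
      with e(1) show "e \<in> (\<lambda>u. {v, u}) ` {u \<in> verts G. u \<noteq> v \<and> vertex_adj G v u}"
        by (auto simp: vertex_adj_def)
    qed (auto simp: vertex_adj_def)
  qed
  then show ?thesis
    unfolding degree_def by (rule bij_betw_same_card)
qed

text \<open>An edge of the transformation graph is an unordered pair, so membership of
  \<open>{p, q}\<close> yields the relation in one of the two orders only; symmetry makes the order
  irrelevant.\<close>

lemma transformation_adj_sym:
  "transformation_adj x y z G p q \<longleftrightarrow> transformation_adj x y z G q p"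
  proof -
  have sym: "vertex_adj G u v = vertex_adj G v u" "edge_adj e f = edge_adj f e"
    for u v and e f :: "'a set"
    by (auto simp: vertex_adj_def edge_adj_def insert_commute)
  show ?thesis
    by (cases p; cases q) (simp_all add: sym)
qed

lemma degree_total_transformation:
  assumes "finite_simple_graph G" "p \<in> verts G <+> edges G"
  shows "degree (total_transformation x y z G) p =
    card {q \<in> verts G <+> edges G. q \<noteq> p \<and> transformation_adj x y z G p q}"
proof -
  let ?H = "total_transformation x y z G"
  have "vertex_adj ?H p q \<longleftrightarrow> transformation_adj x y z G p q"
    if "q \<in> verts G <+> edges G" "q \<noteq> p" for q
    using that assms(2) transformation_adj_sym[of x y z G p q]
    by (auto simp: vertex_adj_def total_transformation_def doubleton_eq_iff)
  then have "{q \<in> verts ?H. q \<noteq> p \<and> vertex_adj ?H p q} =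
    {q \<in> verts G <+> edges G. q \<noteq> p \<and> transformation_adj x y z G p q}"
    by (auto simp: total_transformation_def)
  then show ?thesis
    using card_neighbours_eq_degree[OF finite_simple_graph_total_transformation[OF assms(1)], of x y z p]
    by simp
qed

text \<open>The neighbours of \<open>v\<close> are its neighbours in \<open>G\<close> and the edges
  at \<open>v\<close>, and there are \<open>degree G v\<close> of each kind. The sign
  \<open>y\<close> stays free because it governs only pairs of edges.\<close>

lemma degree_total_transformation_vertex:
  assumes G: "finite_simple_graph G" and v: "v \<in> verts G"
  shows "degree (total_transformation Plus y Plus G) (Inl v) = 2 * degree G v"
proof -
  have "{q \<in> verts G <+> edges G. q \<noteq> Inl v \<and> transformation_adj Plus y Plus G (Inl v) q} =
    {u \<in> verts G. u \<noteq> v \<and> vertex_adj G v u} <+> {e \<in> edges G. v \<in> e}"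
    by auto
  moreover have "finite (verts G)"
    using G by (simp add: finite_simple_graph_def)
  ultimately show ?thesis
    using degree_total_transformation[OF G InlI[OF v], of Plus y Plus]
      card_neighbours_eq_degree[OF G, of v] finite_edges[OF G]
    by (simp add: card_Plus flip: degree_def)
qed

text \<open>Inclusion-exclusion: the edges that meet \<open>e = {u, v}\<close> are those at
  \<open>u\<close> and those at \<open>v\<close>, and only \<open>e\<close> is counted twice, whence
  the \<open>+ 1\<close>. The additive form avoids subtraction on naturals.\<close>

lemma card_disjoint_edges:
  assumes G: "finite_simple_graph G" and e: "e \<in> edges G"
  shows "card {f \<in> edges G. e \<inter> f = {}} + (\<Sum>v\<in>e. degree G v) = card (edges G) + 1"
proof -
  obtain u v where uv: "u \<noteq> v" "e = {u, v}" "u \<in> verts G" "v \<in> verts G"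
    using edge_cases[OF G e] .
  let ?D = "{f \<in> edges G. e \<inter> f = {}}"
  let ?A = "\<lambda>w. {f \<in> edges G. w \<in> f}"
  have fin: "finite ?D" "finite (?A w)" for w
    using finite_edges[OF G] by auto
  \<comment> \<open>There are no parallel edges: two elements already determine an edge.\<close>
  have "f = e" if f: "f \<in> edges G" "u \<in> f" "v \<in> f" for f
  proof -
    obtain a b where "a \<noteq> b" "f = {a, b}" "a \<in> verts G" "b \<in> verts G"
      using edge_cases[OF G f(1)] .
    with f(2,3) uv show ?thesis by auto
  qed
  with e uv have "?A u \<inter> ?A v = {e}" by auto
  then have "card (?A u) + card (?A v) = card (?A u \<union> ?A v) + 1"
    using card_Un_Int[OF fin(2) fin(2), of u v] by simp
  moreover have "card (?D \<union> (?A u \<union> ?A v)) = card ?D + card (?A u \<union> ?A v)"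
    using fin uv by (intro card_Un_disjoint) auto
  moreover have "?D \<union> (?A u \<union> ?A v) = edges G"
    using uv by auto
  ultimately show ?thesis
    using uv by (simp add: degree_def)
qed

lemma degree_total_transformation_edge:
  assumes G: "finite_simple_graph G" and e: "e \<in> edges G"
  shows "int (degree (total_transformation x Minus Plus G) (Inr e)) =
    int (card (edges G)) + 3 - (\<Sum>v\<in>e. int (degree G v))"
proof -
  obtain u v where uv: "u \<noteq> v" "e = {u, v}" "u \<in> verts G" "v \<in> verts G"
    using edge_cases[OF G e] .
  \<comment> \<open>The edge \<open>e\<close>, as a set, is its own set of neighbouring vertices. It
    contributes 2, which with the 1 from \<open>card_disjoint_edges\<close> gives the constant
    3.\<close>
  have "{q \<in> verts G <+> edges G. q \<noteq> Inr e \<and> transformation_adj x Minus Plus G (Inr e) q} =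
    e <+> {f \<in> edges G. e \<inter> f = {}}"
    using uv by (auto simp: edge_adj_def)
  then have "degree (total_transformation x Minus Plus G) (Inr e) =
    card e + card {f \<in> edges G. e \<inter> f = {}}"
    using e uv finite_edges[OF G] by (simp add: degree_total_transformation[OF G] card_Plus InrI)
  moreover have "int (card {f \<in> edges G. e \<inter> f = {}}) + (\<Sum>v\<in>e. int (degree G v)) =
    int (card (edges G)) + 1"
    using arg_cong[OF card_disjoint_edges[OF G e], of int] by simp
  ultimately show ?thesis
    using uv by simp
qed

theorem theorem8:
  fixes G :: "'v graph" and n m :: nat
  assumes "finite_simple_graph G"
    and "connected_graph G"
    and "card (verts G) = n"
    and "card (edges G) = m"
  shows "int (F_index (total_transformation Plus Minus Plus G)) =
      (3 * int m + 17) * int (F_index G)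
      - 3 * (int m + 3) ^ 2 * int (zagreb1 G)
      + 6 * (int m + 3) * int (zagreb2 G)
      - int (xi4 G)
      - 3 * int (ReZG3 G)
      + int m * (int m + 3) ^ 3"
proof -
  note G = assms(1)
  let ?H = "total_transformation Plus Minus Plus G"
  define d where "d v = int (degree G v)" for v
  \<comment> \<open>Power sums and product of the two end degrees: the cube for each edge and all
    the indices are expressed through these.\<close>
  define s where "s k e = (\<Sum>v\<in>e. d v ^ k)" for k :: nat and e
  define p where "p e = (\<Prod>v\<in>e. d v)" for e
  have cube: "(int m + 3 - s 1 e) ^ 3 = (int m + 3) ^ 3 - 3 * (int m + 3) ^ 2 * s 1 e
      + 3 * (int m + 3) * s 2 e + 6 * (int m + 3) * p e - s 3 e - 3 * (p e * s 1 e)"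
    if e: "e \<in> edges G" for e
  proof -
    obtain u v where "u \<noteq> v" "e = {u, v}" "u \<in> verts G" "v \<in> verts G"
      using edge_cases[OF G e] .
    then have "s k e = d u ^ k + d v ^ k" "p e = d u * d v" for k
      by (simp_all add: s_def p_def)
    \<comment> \<open>Binomial expansion in which \<open>(a + b) ^ 2\<close> and
      \<open>(a + b) ^ 3\<close> are split into power sums and multiples of
      \<open>a * b\<close>.\<close>
    moreover have "(M - (a + b)) ^ 3 = M ^ 3 - 3 * M ^ 2 * (a + b) + 3 * M * (a ^ 2 + b ^ 2)
        + 6 * M * (a * b) - (a ^ 3 + b ^ 3) - 3 * (a * b * (a + b))" for M a b :: int
      by algebra
    ultimately show ?thesis
      by (simp only: power_one_right)
  qed
  have sum_s: "(\<Sum>e\<in>edges G. s k e) = (\<Sum>v\<in>verts G. d v ^ Suc k)" for k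
    using sum_edges_sum_ends[OF G, of "\<lambda>v. d v ^ k"] by (simp add: s_def d_def)
  \<comment> \<open>By \<open>sum_s\<close>, summing over edges raises the exponent by one, so
    \<open>s 1\<close>, \<open>s 2\<close>, \<open>s 3\<close> produce the vertex sums of squares,
    cubes and fourth powers.\<close>
  have indices: "int (F_index G) = (\<Sum>e\<in>edges G. s 2 e)" "int (zagreb1 G) = (\<Sum>e\<in>edges G. s 1 e)"
    "int (xi4 G) = (\<Sum>e\<in>edges G. s 3 e)" "int (zagreb2 G) = (\<Sum>e\<in>edges G. p e)"
    "int (ReZG3 G) = (\<Sum>e\<in>edges G. p e * s 1 e)"
    unfolding sum_s
    by (simp_all add: F_index_def zagreb1_def xi4_def zagreb2_def ReZG3_def s_def p_def d_def
        power2_eq_square)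
  have "int (F_index ?H) = (\<Sum>v\<in>verts G. int (degree ?H (Inl v)) ^ 3)
      + (\<Sum>e\<in>edges G. int (degree ?H (Inr e)) ^ 3)"
    using G finite_edges[OF G]
    by (simp add: F_index_def total_transformation_def finite_simple_graph_def sum.Plus)
  also have "(\<Sum>v\<in>verts G. int (degree ?H (Inl v)) ^ 3) = 8 * int (F_index G)"
    by (simp add: degree_total_transformation_vertex[OF G] F_index_def power_mult_distrib
        sum_distrib_left)
  also have "(\<Sum>e\<in>edges G. int (degree ?H (Inr e)) ^ 3) = (\<Sum>e\<in>edges G. (int m + 3 - s 1 e) ^ 3)"
    by (simp add: degree_total_transformation_edge[OF G] assms(4) s_def d_def)
  also have "\<dots> = (\<Sum>e\<in>edges G. (int m + 3) ^ 3 - 3 * (int m + 3) ^ 2 * s 1 e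
      + 3 * (int m + 3) * s 2 e + 6 * (int m + 3) * p e - s 3 e - 3 * (p e * s 1 e))"
    by (rule sum.cong[OF refl cube])
  also have "\<dots> = int m * (int m + 3) ^ 3 - 3 * (int m + 3) ^ 2 * int (zagreb1 G)
      + 3 * (int m + 3) * int (F_index G) + 6 * (int m + 3) * int (zagreb2 G)
      - int (xi4 G) - 3 * int (ReZG3 G)"
    unfolding indices by (simp only: sum.distrib sum_subtractf sum_distrib_left[symmetric]
        sum_constant assms(4))
  \<comment> \<open>The coefficient of \<open>F_index G\<close> is
    \<open>8 + 3 * (m + 3) = 3 * m + 17\<close>, with 8 from the doubled vertex degrees and the rest
    from the \<open>s 2\<close> terms.\<close>
  finally show ?thesis
    by (simp add: algebra_simps)
qed

end
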